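(* For every even integer $k > 6$ and every integer $y \geq 2$, the graph $K_3 \times K_{ky}$ has a $C_k$-factorization.
   Context: $K_n$ is the complete graph on $n$ vertices. For graphs $G,H$, the tensor product $G \times H$ has vertex set $V(G)\times V(H)$, with $(g_1,h_1)$ adjacent to $(g_2,h_2)$ iff $g_1g_2 \in E(G)$ and $h_1h_2 \in E(H)$. A $C_k$-factor of a graph is a spanning subgraph all of whose components are cycles of length $k$; a $C_k$-factorization is a partition of the edge set into $C_k$-factors. *)

theory Defs
  imports Main "HOL-Library.Disjoint_Sets"
begin

text \<open>Undirected graphs without loops or multiple edges: an edge is the two-element set of its ends.\<close>

record 'a ugraph =
  verts :: "'a set"
  edges :: "'a set set"

definition simple_graph :: "'a ugraph \<Rightarrow> bool" where
  "simple_graph G \<longleftrightarrow> (\<forall>e\<in>edges G. e \<subseteq> verts G \<and> card e = 2)"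

definition complete_graph :: "nat \<Rightarrow> nat ugraph" where
  "complete_graph n = \<lparr>verts = {..<n}, edges = {e. e \<subseteq> {..<n} \<and> card e = 2}\<rparr>"

definition tensor_product :: "'a ugraph \<Rightarrow> 'b ugraph \<Rightarrow> ('a \<times> 'b) ugraph" where
  "tensor_product G H =
     \<lparr>verts = verts G \<times> verts H,
      edges = {{(g1, h1), (g2, h2)} | g1 h1 g2 h2. {g1, g2} \<in> edges G \<and> {h1, h2} \<in> edges H}\<rparr>"

definition spanning_subgraph :: "'a ugraph \<Rightarrow> 'a ugraph \<Rightarrow> bool" where
  "spanning_subgraph F G \<longleftrightarrow> verts F = verts G \<and> edges F \<subseteq> edges G"

definition induced_subgraph :: "'a ugraph \<Rightarrow> 'a set \<Rightarrow> 'a ugraph" where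
  "induced_subgraph G S = \<lparr>verts = S, edges = {e \<in> edges G. e \<subseteq> S}\<rparr>"

definition reachable_from :: "'a ugraph \<Rightarrow> 'a \<Rightarrow> 'a set" where
  "reachable_from G v = {(x, y). {x, y} \<in> edges G}\<^sup>* `` {v}"

definition components :: "'a ugraph \<Rightarrow> 'a ugraph set" where
  "components G = (\<lambda>v. induced_subgraph G (reachable_from G v)) ` verts G"

definition is_cycle :: "nat \<Rightarrow> 'a ugraph \<Rightarrow> bool" where
  "is_cycle k C \<longleftrightarrow> k \<ge> 3 \<and>
     (\<exists>xs. distinct xs \<and> length xs = k \<and> verts C = set xs \<and>
           edges C = {{xs ! i, xs ! (Suc i mod k)} | i. i < k})"

definition is_cycle_factor :: "nat \<Rightarrow> 'a ugraph \<Rightarrow> 'a ugraph \<Rightarrow> bool" where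
  "is_cycle_factor k F G \<longleftrightarrow> spanning_subgraph F G \<and> (\<forall>C\<in>components F. is_cycle k C)"

text \<open>A spanning subgraph is determined by its edge set, so a factorization is recorded as the
  set of the edge sets of its factors.\<close>

definition is_cycle_factorization :: "nat \<Rightarrow> 'a ugraph \<Rightarrow> 'a set set set \<Rightarrow> bool" where
  "is_cycle_factorization k G P \<longleftrightarrow> partition_on (edges G) P \<and>
     (\<forall>M\<in>P. is_cycle_factor k \<lparr>verts = verts G, edges = M\<rparr> G)"

lemma simple_graph_complete_graph: "simple_graph (complete_graph n)"
  by (auto simp: simple_graph_def complete_graph_def)

lemma complete_graph_adjacent_iff:
  "{u, v} \<in> edges (complete_graph n) \<longleftrightarrow> u < n \<and> v < n \<and> u \<noteq> v"
  by (auto simp: complete_graph_def card_insert_if)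

lemma tensor_product_adjacent_iff:
  "{(g1, h1), (g2, h2)} \<in> edges (tensor_product G H) \<longleftrightarrow>
     {g1, g2} \<in> edges G \<and> {h1, h2} \<in> edges H"
  by (auto simp: tensor_product_def doubleton_eq_iff insert_commute)

lemma simple_graph_tensor_product:
  assumes "simple_graph G" and "simple_graph H"
  shows "simple_graph (tensor_product G H)"
proof -
  have "{(g1, h1), (g2, h2)} \<subseteq> verts G \<times> verts H \<and> card {(g1, h1), (g2, h2)} = 2"
    if "{g1, g2} \<in> edges G" "{h1, h2} \<in> edges H" for g1 g2 h1 h2
  proof -
    have "{g1, g2} \<subseteq> verts G" "card {g1, g2} = 2" "{h1, h2} \<subseteq> verts H"
      using assms that unfolding simple_graph_def by blast+
    then show ?thesis by (auto simp: card_insert_if split: if_splits)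
  qed
  then show ?thesis by (auto 0 3 simp: simple_graph_def tensor_product_def)
qed

end

theory Submission imports Defs begin

text \<open>
  Let k = 2m. Split the vertices of the complete graph on ky = 2y * m vertices into 2y groups of
  size m and take a 1-factorization of the complete graph on the groups. Pairs of groups in one of
  its 1-factors carry a \<open>K_{2m}\<close>, pairs in any other 1-factor carry a \<open>K_{m,m}\<close>. So it is enough
  to resolve \<open>K_3 \<times> H\<close> into k-cycles for these two graphs H on k vertices.

  Each such H has a proper edge colouring by the integers mod r in which the classes i and i + 1
  always form a Hamiltonian cycle. Over an edge of H lie two perfect matchings of a 6-cycle, given by
  the voltages 1 and -1 mod 3. Choose a voltage x on every edge; factor i takes voltage x over the
  edges of colour i and voltage -x over those of colour i + 1. It consists of three k-cycles as
  soon as the voltages along the i-th Hamiltonian cycle add up to 0 mod 3.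
\<close>

section \<open>Resolutions into cycles\<close>

definition cycle_edges :: "'a list \<Rightarrow> 'a set set" where
  "cycle_edges xs = {{xs ! i, xs ! (Suc i mod length xs)} | i. i < length xs}"

text \<open>A local way to say that all components are \<open>k\<close>-cycles: the edges of
  \<open>M\<close> meeting the cycle through \<open>v\<close> are exactly its own. As no
  reachability occurs, this passes easily to disjoint unions and injective images. Nonemptiness is
  demanded separately because an empty edge meets no cycle.\<close>

definition cycle_cover :: "nat \<Rightarrow> 'a set \<Rightarrow> 'a set set \<Rightarrow> bool" where
  "cycle_cover k V M \<longleftrightarrow> (\<forall>e\<in>M. e \<noteq> {} \<and> e \<subseteq> V) \<and>
     (\<forall>v\<in>V. \<exists>xs. distinct xs \<and> length xs = k \<and> v \<in> set xs \<and> set xs \<subseteq> V \<and>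
        {e \<in> M. e \<inter> set xs \<noteq> {}} = cycle_edges xs)"

text \<open>The classes are indexed by numbers below r, so that
  resolutions of disjoint graphs can be merged class by class.\<close>

definition resolvable :: "nat \<Rightarrow> 'a set \<Rightarrow> 'a set set \<Rightarrow> nat \<Rightarrow> bool" where
  "resolvable k V E r \<longleftrightarrow> (\<exists>f. (\<forall>i<r. cycle_cover k V (f i)) \<and> disjoint_family_on f {..<r} \<and>
     E = (\<Union>i<r. f i))"

text \<open>For symmetric and irreflexive \<open>R\<close> this is the edge set of the tensor
  product of the triangle on 0, 1, 2 with the graph whose adjacency is \<open>R\<close>.\<close>

definition triple_edges :: "('v \<Rightarrow> 'v \<Rightarrow> bool) \<Rightarrow> (nat \<times> 'v) set set" where
  "triple_edges R = {{(a, u), (b, v)} | a b u v. a < 3 \<and> b < 3 \<and> a \<noteq> b \<and> R u v}"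

text \<open>Closed walks are given as functions of the position; \<open>g k = g 0\<close> turns the
  wrap-around index of \<open>cycle_edges\<close> into an ordinary successor step.\<close>

lemma cycle_edges_map_upt:
  assumes "g k = g 0"
  shows "cycle_edges (map g [0..<k]) = {{g l, g (Suc l)} | l. l < k}"
proof -
  have *: "map g [0..<k] ! l = g l \<and> map g [0..<k] ! (Suc l mod k) = g (Suc l)" if "l < k" for l
  proof (cases "Suc l = k")
    case True
    then show ?thesis using that assms by (auto simp: mod_self)
  next
    case False
    then show ?thesis using that by auto
  qed
  show ?thesis unfolding cycle_edges_def
    using * by (intro Collect_cong ex_cong1) auto
qed

lemma cycle_edges_subset: "e \<in> cycle_edges xs \<Longrightarrow> e \<subseteq> set xs"
  by (cases "xs = []") (auto simp: cycle_edges_def)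

text \<open>An edge of \<open>M\<close> that meets the cycle through \<open>v\<close> belongs to it,
  so no walk from \<open>v\<close> leaves the cycle, while walking along it reaches all its
  vertices. Hence the cycle is the component of \<open>v\<close>.\<close>

lemma cycle_cover_imp_cycle_factor:
  assumes "k \<ge> 3" "cycle_cover k (verts G) M" "M \<subseteq> edges G"
  shows "is_cycle_factor k \<lparr>verts = verts G, edges = M\<rparr> G"
proof -
  let ?F = "\<lparr>verts = verts G, edges = M\<rparr>"
  have "is_cycle k (induced_subgraph ?F (reachable_from ?F v))" if v: "v \<in> verts G" for v
  proof -
    obtain xs where xs: "distinct xs" "length xs = k" "v \<in> set xs"
      and M: "{e \<in> M. e \<inter> set xs \<noteq> {}} = cycle_edges xs"
      using assms(2) v unfolding cycle_cover_def by blast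
    define S where "S = {(x, y). {x, y} \<in> M}"
    have closed: "y \<in> set xs" if "(v, y) \<in> S\<^sup>*" for y
      using that
    proof induction
      case (step y z)
      then have "{y, z} \<in> cycle_edges xs" using M by (auto simp: S_def)
      then show ?case using cycle_edges_subset by blast
    qed (rule xs)
    have edge: "(xs ! i, xs ! (Suc i mod k)) \<in> S" if "i < k" for i
    proof -
      have "{xs ! i, xs ! (Suc i mod k)} \<in> cycle_edges xs" using that xs by (auto simp: cycle_edges_def)
      then show ?thesis using M by (auto simp: S_def)
    qed
    have sym: "sym (S\<^sup>*)" by (rule sym_rtrancl) (auto simp: sym_def S_def insert_commute)
    have r0: "(xs ! 0, xs ! i) \<in> S\<^sup>*" if "i < k" for i
      using that
    proof (induction i)
      case (Suc i)
      then show ?case using edge[of i] by (auto intro: rtrancl_into_rtrancl)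
    qed auto
    have "(v, y) \<in> S\<^sup>*" if "y \<in> set xs" for y
      using r0 that xs sym by (metis in_set_conv_nth rtrancl_trans symD)
    then have reach: "reachable_from ?F v = set xs"
      using closed by (auto simp: reachable_from_def S_def)
    \<comment> \<open>The induced subgraph keeps the edges contained in the component, the cover
      speaks of those meeting it; nonemptiness of edges bridges the two.\<close>
    have "{e \<in> M. e \<subseteq> set xs} = cycle_edges xs"
    proof (intro equalityI subsetI)
      fix e assume "e \<in> {e \<in> M. e \<subseteq> set xs}"
      moreover have "e \<noteq> {}" if "e \<in> M" using assms(2) that unfolding cycle_cover_def by simp
      ultimately show "e \<in> cycle_edges xs" using M by blast
    next
      fix e assume "e \<in> cycle_edges xs"
      then show "e \<in> {e \<in> M. e \<subseteq> set xs}" using M cycle_edges_subset by blast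
    qed
    then show ?thesis
      using xs assms(1) by (auto simp: is_cycle_def induced_subgraph_def reach cycle_edges_def)
  qed
  then show ?thesis using assms(3)
    by (auto simp: is_cycle_factor_def spanning_subgraph_def components_def)
qed

lemma cycle_cover_edgeD:
  assumes "cycle_cover k V M" "e \<in> M"
  shows "e \<noteq> {}" "e \<subseteq> V"
  using assms unfolding cycle_cover_def by simp_all

text \<open>An edge of another member stays inside that member's vertex set, so by disjointness it
  cannot meet the cycle chosen here.\<close>

lemma cycle_cover_disjoint_Union:
  assumes "\<And>j. j \<in> J \<Longrightarrow> cycle_cover k (V j) (M j)" "disjoint_family_on V J"
  shows "cycle_cover k (\<Union>j\<in>J. V j) (\<Union>j\<in>J. M j)"
  unfolding cycle_cover_def
proof (intro conjI ballI)
  fix v assume "v \<in> (\<Union>j\<in>J. V j)"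
  then obtain j where j: "j \<in> J" "v \<in> V j" by auto
  then obtain xs where xs: "distinct xs" "length xs = k" "v \<in> set xs" "set xs \<subseteq> V j"
    and M: "{e \<in> M j. e \<inter> set xs \<noteq> {}} = cycle_edges xs"
    using assms(1)[OF j(1)] unfolding cycle_cover_def by blast
  have "e \<in> M j" if "j' \<in> J" "e \<in> M j'" "e \<inter> set xs \<noteq> {}" for e j'
  proof -
    have "e \<subseteq> V j'" using assms(1) that unfolding cycle_cover_def by blast
    then have "V j \<inter> V j' \<noteq> {}" using that xs by blast
    then have "j = j'" using assms(2) j that unfolding disjoint_family_on_def by blast
    then show ?thesis using that by simp
  qed
  then have "{e \<in> \<Union> (M ` J). e \<inter> set xs \<noteq> {}} = cycle_edges xs"
    using M j by blast
  then show "\<exists>xs. distinct xs \<and> length xs = k \<and> v \<in> set xs \<and> set xs \<subseteq> \<Union> (V ` J) \<and>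
      {e \<in> \<Union> (M ` J). e \<inter> set xs \<noteq> {}} = cycle_edges xs"
    using xs j by (intro exI[of _ xs]) auto
qed (use assms(1) cycle_cover_edgeD in \<open>fast+\<close>)

text \<open>Class \<open>i\<close> of the union collects the classes \<open>i\<close> of all parts,
  which is why the parts share one \<open>r\<close>. Edges are nonempty, so an edge determines its
  part and the classes stay disjoint.\<close>

lemma resolvable_disjoint_Union:
  assumes "\<And>j. j \<in> J \<Longrightarrow> resolvable k (V j) (E j) r" "disjoint_family_on V J"
  shows "resolvable k (\<Union>j\<in>J. V j) (\<Union>j\<in>J. E j) r"
proof -
  have "\<forall>j\<in>J. \<exists>f. (\<forall>i<r. cycle_cover k (V j) (f i)) \<and> disjoint_family_on f {..<r} \<and>
     E j = (\<Union>i<r. f i)"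
    using assms(1) unfolding resolvable_def by blast
  then obtain f where f: "\<And>j i. j \<in> J \<Longrightarrow> i < r \<Longrightarrow> cycle_cover k (V j) (f j i)"
      "\<And>j. j \<in> J \<Longrightarrow> disjoint_family_on (f j) {..<r}" "\<And>j. j \<in> J \<Longrightarrow> E j = (\<Union>i<r. f j i)"
    by metis
  have same: "j = j'" if "j \<in> J" "j' \<in> J" "i < r" "i' < r" "e \<in> f j i" "e \<in> f j' i'" for j j' i i' e
  proof -
    have "e \<noteq> {}" "e \<subseteq> V j" "e \<subseteq> V j'" using f(1) that unfolding cycle_cover_def by blast+
    then show ?thesis using that assms(2) unfolding disjoint_family_on_def by blast
  qed
  have "disjoint_family_on (\<lambda>i. \<Union>j\<in>J. f j i) {..<r}"
    unfolding disjoint_family_on_def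
  proof (intro ballI impI)
    fix i i' assume i: "i \<in> {..<r}" "i' \<in> {..<r}" "i \<noteq> i'"
    have False if "e \<in> (\<Union>j\<in>J. f j i) \<inter> (\<Union>j\<in>J. f j i')" for e
    proof -
      obtain j j' where "j \<in> J" "j' \<in> J" "e \<in> f j i" "e \<in> f j' i'" using \<open>e \<in> _\<close> by auto
      then show False using same[of j j' i i' e] i f(2)[of j] unfolding disjoint_family_on_def by auto
    qed
    then show "(\<Union>j\<in>J. f j i) \<inter> (\<Union>j\<in>J. f j i') = {}" by blast
  qed
  moreover have "(\<Union>j\<in>J. E j) = (\<Union>i<r. \<Union>j\<in>J. f j i)" using f(3) by auto
  ultimately show ?thesis unfolding resolvable_def
    using cycle_cover_disjoint_Union[OF f(1) assms(2)] by (intro exI[of _ "\<lambda>i. \<Union>j\<in>J. f j i"]) auto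
qed

section \<open>Transport along injective maps\<close>

lemma cycle_edges_map: "cycle_edges (map h xs) = (`) h ` cycle_edges xs"
proof -
  have "Suc i mod length xs < length xs" if "i < length xs" for i
    using that by (cases xs) auto
  then have "{{map h xs ! i, map h xs ! (Suc i mod length xs)} | i. i < length xs} =
      {h ` {xs ! i, xs ! (Suc i mod length xs)} | i. i < length xs}"
    by (intro Collect_cong ex_cong1) auto
  also have "\<dots> = (`) h ` {{xs ! i, xs ! (Suc i mod length xs)} | i. i < length xs}"
    by blast
  finally show ?thesis by (simp add: cycle_edges_def)
qed

lemma cycle_cover_image:
  assumes "cycle_cover k V M" "inj_on h V"
  shows "cycle_cover k (h ` V) ((`) h ` M)"
  unfolding cycle_cover_def
proof (intro conjI ballI)
  fix v' assume "v' \<in> h ` V"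
  then obtain v where v: "v \<in> V" "v' = h v" by auto
  then obtain xs where xs: "distinct xs" "length xs = k" "v \<in> set xs" "set xs \<subseteq> V"
    and M: "{e \<in> M. e \<inter> set xs \<noteq> {}} = cycle_edges xs"
    using assms(1) unfolding cycle_cover_def by blast
  have "h ` e \<inter> h ` set xs = h ` (e \<inter> set xs)" if "e \<in> M" for e
    using that xs assms unfolding cycle_cover_def by (metis inj_on_image_Int)
  then have "{e \<in> (`) h ` M. e \<inter> set (map h xs) \<noteq> {}} = (`) h ` {e \<in> M. e \<inter> set xs \<noteq> {}}"
    by auto
  then show "\<exists>xs. distinct xs \<and> length xs = k \<and> v' \<in> set xs \<and> set xs \<subseteq> h ` V \<and>
      {e \<in> (`) h ` M. e \<inter> set xs \<noteq> {}} = cycle_edges xs"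
    using xs v M assms(2) by (intro exI[of _ "map h xs"])
      (auto simp: cycle_edges_map distinct_map intro: inj_on_subset)
qed (use cycle_cover_edgeD[OF assms(1)] in \<open>auto\<close>)

lemma resolvable_image:
  assumes "resolvable k V E r" "inj_on h V"
  shows "resolvable k (h ` V) ((`) h ` E) r"
proof -
  obtain f where f: "\<And>i. i < r \<Longrightarrow> cycle_cover k V (f i)"
      "disjoint_family_on f {..<r}" "E = (\<Union>i<r. f i)"
    using assms(1) unfolding resolvable_def by blast
  have sub: "e \<subseteq> V" if "i < r" "e \<in> f i" for i e using f(1) that unfolding cycle_cover_def by blast
  have "disjoint_family_on (\<lambda>i. (`) h ` f i) {..<r}"
    unfolding disjoint_family_on_def
  proof (intro ballI impI)
    fix i i' assume i: "i \<in> {..<r}" "i' \<in> {..<r}" "i \<noteq> i'"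
    have False if e: "e \<in> f i" "e' \<in> f i'" "h ` e = h ` e'" for e e'
    proof -
      have "e = e'" using inj_on_image_eq_iff[OF assms(2)] sub e i by (metis lessThan_iff)
      then show False using f(2) i e unfolding disjoint_family_on_def by blast
    qed
    then show "(`) h ` f i \<inter> (`) h ` f i' = {}" by blast
  qed
  then show ?thesis unfolding resolvable_def
    using cycle_cover_image[OF f(1) assms(2)] f(3) by (intro exI[of _ "\<lambda>i. (`) h ` f i"]) auto
qed

text \<open>Serves to carry the two model resolutions on \<open>{..<2 * m}\<close> over to a pair of
  groups; the triangle coordinate stays fixed.\<close>

lemma resolvable_triple_image:
  assumes "resolvable k ({..<3} \<times> V) (triple_edges R) r" "inj_on h V"
  shows "resolvable k ({..<3} \<times> h ` V) (triple_edges (\<lambda>u v. \<exists>u' v'. u = h u' \<and> v = h v' \<and> R u' v')) r"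
proof -
  have "inj_on (map_prod id h) ({..<3::nat} \<times> V)" using assms(2) by (auto simp: inj_on_def)
  from resolvable_image[OF assms(1) this]
  have "resolvable k (map_prod id h ` ({..<3} \<times> V)) ((`) (map_prod id h) ` triple_edges R) r" .
  moreover have "map_prod id h ` ({..<3::nat} \<times> V) = {..<3} \<times> h ` V"
    using map_prod_surj_on[of id "{..<3}" "{..<3}" h V "h ` V"] by simp
  moreover have "(`) (map_prod id h) ` triple_edges R =
      triple_edges (\<lambda>u v. \<exists>u' v'. u = h u' \<and> v = h v' \<and> R u' v')" (is "?L = ?R")
  proof
    show "?L \<subseteq> ?R"
    proof
      fix e assume "e \<in> ?L"
      then obtain a b u v where e: "e = map_prod id h ` {(a, u), (b, v)}" "a < 3" "b < 3" "a \<noteq> b" "R u v"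
        unfolding triple_edges_def by blast
      then have "e = {(a, h u), (b, h v)}" by simp
      then show "e \<in> ?R" unfolding triple_edges_def using e(2-) by blast
    qed
    show "?R \<subseteq> ?L"
    proof
      fix e assume "e \<in> ?R"
      then obtain a b u v where e: "e = {(a, h u), (b, h v)}" "a < 3" "b < 3" "a \<noteq> b" "R u v"
        unfolding triple_edges_def by auto
      then have "e = map_prod id h ` {(a, u), (b, v)}" "{(a, u), (b, v)} \<in> triple_edges R"
        unfolding triple_edges_def by auto
      then show "e \<in> ?L" by blast
    qed
  qed
  ultimately show ?thesis by simp
qed

text \<open>The blocks are all classes of all the resolutions together; the number of classes may
  vary with \<open>t\<close>.\<close>

lemma resolvable_imp_cycle_factorization:
  assumes "k \<ge> 3" "verts G \<noteq> {}"
    and "\<And>t. t \<in> T \<Longrightarrow> resolvable k (verts G) (E t) (r t)"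
    and "disjoint_family_on E T" "edges G = (\<Union>t\<in>T. E t)"
  shows "\<exists>P. is_cycle_factorization k G P"
proof -
  have "\<forall>t\<in>T. \<exists>f. (\<forall>i<r t. cycle_cover k (verts G) (f i)) \<and> disjoint_family_on f {..<r t} \<and>
     E t = (\<Union>i<r t. f i)"
    using assms(3) unfolding resolvable_def by blast
  then obtain f where f: "\<And>t i. t \<in> T \<Longrightarrow> i < r t \<Longrightarrow> cycle_cover k (verts G) (f t i)"
      "\<And>t. t \<in> T \<Longrightarrow> disjoint_family_on (f t) {..<r t}" "\<And>t. t \<in> T \<Longrightarrow> E t = (\<Union>i<r t. f t i)"
    by metis
  define P where "P = (\<Union>t\<in>T. f t ` {..<r t})"
  \<comment> \<open>A partition has no empty block: the cover has a cycle through some vertex, and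
    that cycle has an edge.\<close>
  have ne: "M \<noteq> {}" if cov: "cycle_cover k (verts G) M" for M
  proof -
    obtain v where "v \<in> verts G" using assms(2) by blast
    then obtain xs where "length xs = k" "{e \<in> M. e \<inter> set xs \<noteq> {}} = cycle_edges xs"
      using cov unfolding cycle_cover_def by blast
    moreover have "{xs ! 0, xs ! (Suc 0 mod length xs)} \<in> cycle_edges xs" if "length xs \<ge> 3"
      using that unfolding cycle_edges_def by force
    ultimately show ?thesis using assms(1) by blast
  qed
  have un: "\<Union> P = edges G" using f(3) assms(5) unfolding P_def by auto
  have "M \<inter> M' = {}" if MP: "M \<in> P" "M' \<in> P" and ne: "M \<noteq> M'" for M M'
  proof -
    obtain t i t' i' where t: "t \<in> T" "t' \<in> T" "i < r t" "i' < r t'" "M = f t i" "M' = f t' i'"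
      using MP unfolding P_def by auto
    show ?thesis
    proof (cases "t = t'")
      case True
      then have "i \<noteq> i'" using t ne by auto
      then show ?thesis using True t f(2)[of t] unfolding disjoint_family_on_def by simp
    next
      case False
      then have "E t \<inter> E t' = {}" using assms(4) t unfolding disjoint_family_on_def by blast
      then show ?thesis using t f(3) by blast
    qed
  qed
  moreover have cov: "cycle_cover k (verts G) M" if "M \<in> P" for M using that f(1) unfolding P_def by auto
  moreover have "{} \<notin> P" using ne cov by blast
  ultimately have "partition_on (edges G) P"
    using un by (intro partition_onI) (auto simp: disjnt_def)
  then have "is_cycle_factorization k G P"
    unfolding is_cycle_factorization_def
    using cycle_cover_imp_cycle_factor[OF assms(1) cov] un by blast
  then show ?thesis ..
qed

section \<open>Lifting Hamiltonian cycles along voltages\<close>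

text \<open>Of the six edges \<open>{(a, u), (b, v)}\<close> over an edge uv, three have b - a =
  \<open>x u v\<close> and three have b - a = \<open>- x u v\<close> modulo 3. Along
  \<open>w i\<close> the colours alternate, so the levels change by \<open>x\<close> with
  alternating signs. As the total is 0, every lift closes after one round, and the three starting
  levels give three cycles.\<close>

lemma resolvable_voltage_lift:
  fixes w :: "nat \<Rightarrow> nat \<Rightarrow> 'v" and x :: "'v \<Rightarrow> 'v \<Rightarrow> int"
  assumes k: "even k" "k > 0"
    and R_sym: "\<And>u v. R u v \<Longrightarrow> R v u"
    and R_V: "\<And>u v. R u v \<Longrightarrow> u \<in> V"
    and col_sym: "\<And>u v. R u v \<Longrightarrow> col v u = col u v"
    and col_less: "\<And>u v. R u v \<Longrightarrow> col u v < r"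
    and proper: "\<And>u v v'. R u v \<Longrightarrow> R u v' \<Longrightarrow> col u v = col u v' \<Longrightarrow> v = v'"
    and x_anti: "\<And>u v. R u v \<Longrightarrow> x v u = - x u v"
    and x_unit: "\<And>u v. R u v \<Longrightarrow> x u v = 1 \<or> x u v = - 1"
    and w_bij: "\<And>i. i < r \<Longrightarrow> bij_betw (w i) {..<k} V"
    and w_closed: "\<And>i. i < r \<Longrightarrow> w i k = w i 0"
    and w_edge: "\<And>i l. i < r \<Longrightarrow> l < k \<Longrightarrow> R (w i l) (w i (Suc l))"
    and w_col: "\<And>i l. i < r \<Longrightarrow> l < k \<Longrightarrow>
      col (w i l) (w i (Suc l)) = (if even l then i else Suc i mod r)"
    and w_sum: "\<And>i. i < r \<Longrightarrow> (\<Sum>l<k. (- 1) ^ l * x (w i l) (w i (Suc l))) mod 3 = 0"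
  shows "resolvable k ({..<3} \<times> V) (triple_edges R) r"
proof -
  \<comment> \<open>\<open>S \<epsilon> c\<close> is the adjacency over colour \<open>c\<close> with
    voltages \<open>\<epsilon> * x\<close>: antisymmetry of \<open>x\<close> makes it symmetric,
    properness of \<open>col\<close> makes it a matching. \<open>Q i\<close> is the adjacency of
    factor \<open>i\<close>.\<close>
  define S :: "int \<Rightarrow> nat \<Rightarrow> nat \<times> 'v \<Rightarrow> nat \<times> 'v \<Rightarrow> bool" where
    "S = (\<lambda>\<epsilon> c p q. fst p < 3 \<and> fst q < 3 \<and> R (snd p) (snd q) \<and> col (snd p) (snd q) = c \<and>
      (int (fst q) - int (fst p) - \<epsilon> * x (snd p) (snd q)) mod 3 = 0)"
  define Q where "Q = (\<lambda>i p q. S 1 i p q \<or> S (- 1) (Suc i mod r) p q)"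
  define f where "f = (\<lambda>i. {{p, q} | p q. Q i p q})"
  have S_sym: "S \<epsilon> c q p" if "S \<epsilon> c p q" for \<epsilon> c p q
  proof -
    have R: "R (snd p) (snd q)" using that by (simp add: S_def)
    have "int (fst p) - int (fst q) - \<epsilon> * x (snd q) (snd p) =
        - (int (fst q) - int (fst p) - \<epsilon> * x (snd p) (snd q))"
      using x_anti[OF R] by (simp add: algebra_simps)
    then show ?thesis using that R_sym[OF R] col_sym[OF R] unfolding S_def
      by (metis dvd_eq_mod_eq_0 dvd_minus_iff)
  qed
  have S_det: "q = q'" if "S \<epsilon> c p q" "S \<epsilon> c p q'" for \<epsilon> c p q q'
  proof -
    have v: "snd q = snd q'" using that proper[of "snd p" "snd q" "snd q'"] by (simp add: S_def)
    have "int (fst q) mod 3 = int (fst q') mod 3"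
      using that v unfolding S_def by (smt (verit) mod_eq_dvd_iff dvd_eq_mod_eq_0 dvd_diff)
    then have "fst q = fst q'" using that unfolding S_def by auto
    then show ?thesis using v by (simp add: prod_eq_iff)
  qed
  have Q_sym: "Q i q p" if "Q i p q" for i p q using that S_sym unfolding Q_def by blast
  have in_f: "{p, q} \<in> f i \<longleftrightarrow> Q i p q" for p q i
    unfolding f_def mem_Collect_eq doubleton_eq_iff using Q_sym by blast
  have cover: "cycle_cover k ({..<3} \<times> V) (f i)" if i: "i < r" for i
    unfolding cycle_cover_def
  proof (intro conjI ballI)
    fix e assume "e \<in> f i"
    then obtain p q where pq: "e = {p, q}" "Q i p q" unfolding f_def by auto
    then have "fst p < 3" "fst q < 3" "R (snd p) (snd q)" unfolding Q_def S_def by auto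
    then show "e \<noteq> {}" "e \<subseteq> {..<3} \<times> V"
      using pq R_sym R_V by (auto simp: mem_Times_iff)
  next
    fix pt :: "nat \<times> 'v" assume "pt \<in> {..<3} \<times> V"
    then obtain a u where pt: "pt = (a, u)" "a < 3" "u \<in> V" by auto
    then obtain l0 where l0: "l0 < k" "w i l0 = u"
      using w_bij[OF i] unfolding bij_betw_def by auto
    \<comment> \<open>\<open>\<gamma>\<close> sums the signed voltages along the walk;
      \<open>z\<close> is the lift whose starting level is chosen so that \<open>z l0\<close> is the
      given vertex \<open>pt\<close>.\<close>
    define \<gamma> where "\<gamma> l = (\<Sum>j<l. (- 1) ^ j * x (w i j) (w i (Suc j)))" for l
    define z where "z l = (nat ((int a - \<gamma> l0 + \<gamma> l) mod 3), w i l)" for l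
    have zk: "z k = z 0"
    proof -
      have "\<gamma> k mod 3 = \<gamma> 0 mod 3" using w_sum[OF i] unfolding \<gamma>_def by simp
      then have "(int a - \<gamma> l0 + \<gamma> k) mod 3 = (int a - \<gamma> l0 + \<gamma> 0) mod 3"
        by (rule mod_add_cong[OF refl])
      then show ?thesis using w_closed[OF i] by (simp add: z_def)
    qed
    have zS: "S (if even l then 1 else - 1) (if even l then i else Suc i mod r) (z l) (z (Suc l))"
      if l: "l < k" for l
    proof -
      define s where "s = int a - \<gamma> l0 + \<gamma> l"
      define d where "d = (if even l then 1 else - 1) * x (w i l) (w i (Suc l))"
      have "int a - \<gamma> l0 + \<gamma> (Suc l) = s + d" by (simp add: s_def d_def \<gamma>_def del: add_diff_eq)
      then have z: "z l = (nat (s mod 3), w i l)" "z (Suc l) = (nat ((s + d) mod 3), w i (Suc l))"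
        by (simp_all only: z_def flip: s_def)
      have "((s + d) mod 3 - s mod 3 - d) mod 3 = (s + d - s - d) mod 3"
        by (metis mod_diff_eq mod_diff_left_eq mod_mod_trivial)
      then have "((s + d) mod 3 - s mod 3 - d) mod 3 = 0" by simp
      then show ?thesis using w_edge[OF i l] w_col[OF i l]
        unfolding S_def z by (simp add: d_def nat_less_iff)
    qed
    then have zQ: "Q i (z l) (z (Suc l))" if "l < k" for l
      using that unfolding Q_def by (metis (full_types))
    define xs where "xs = map z [0..<k]"
    have cyc: "cycle_edges xs = {{z l, z (Suc l)} | l. l < k}"
      unfolding xs_def by (rule cycle_edges_map_upt[of z, OF zk])
    have nbr: "{z l, q} \<in> cycle_edges xs" if l: "l < k" and Q: "Q i (z l) q" for l q
    proof -
      \<comment> \<open>The cyclic predecessor of \<open>l\<close>. As \<open>k\<close> is even,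
        parity alternates at the wrap-around too, so the two cycle edges at \<open>z l\<close> come
        from the two matchings in \<open>Q i\<close>, and \<open>S_det\<close> excludes further
        neighbours.\<close>
      define l' where "l' = (if l = 0 then k - 1 else l - 1)"
      have l': "l' < k" "z (Suc l') = z l" "even l' \<longleftrightarrow> odd l"
        using l k zk unfolding l'_def by auto
      have a: "S (if even l then 1 else - 1) (if even l then i else Suc i mod r) (z l) (z (Suc l))"
        using zS[OF l] .
      have b: "S (if even l then - 1 else 1) (if even l then Suc i mod r else i) (z l) (z l')"
        using S_sym[OF zS[OF l'(1)]] l' by (simp split: if_splits)
      have "q = z (Suc l) \<or> q = z l'"
        using Q a b S_det unfolding Q_def by (cases "even l") (simp; blast)+
      then show ?thesis
      proof
        assume "q = z (Suc l)"
        then show ?thesis using l cyc by blast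
      next
        assume "q = z l'"
        then have "{z l, q} = {z l', z (Suc l')}" using l' by auto
        then show ?thesis using l' cyc by blast
      qed
    qed
    have set_xs: "set xs = z ` {..<k}" unfolding xs_def by auto
    have "{e \<in> f i. e \<inter> set xs \<noteq> {}} = cycle_edges xs"
    proof (intro equalityI subsetI CollectI conjI)
      fix e assume "e \<in> {e \<in> f i. e \<inter> set xs \<noteq> {}}"
      then obtain p q where pq: "e = {p, q}" "Q i p q" and "e \<inter> set xs \<noteq> {}"
        unfolding f_def by blast
      then obtain l where "l < k" "p = z l \<or> q = z l" unfolding set_xs by blast
      then obtain q' where "e = {z l, q'}" "Q i (z l) q'" using Q_sym pq by (metis insert_commute)
      then show "e \<in> cycle_edges xs" using nbr \<open>l < k\<close> by simp
    next
      fix e assume "e \<in> cycle_edges xs"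
      then obtain l where "l < k" "e = {z l, z (Suc l)}" using cyc by auto
      then show "e \<in> f i" "e \<inter> set xs \<noteq> {}" using in_f zQ set_xs by auto
    qed
    moreover have "inj_on z {..<k}"
      using w_bij[OF i] unfolding bij_betw_def inj_on_def z_def by auto
    then have "distinct xs" unfolding xs_def by (simp add: distinct_map lessThan_atLeast0)
    moreover have "pt = z l0" using pt l0 by (simp add: z_def)
    then have "pt \<in> set xs" using l0 set_xs by auto
    moreover have "set xs \<subseteq> {..<3} \<times> V"
      using w_bij[OF i] unfolding set_xs z_def bij_betw_def by (auto simp: nat_less_iff)
    moreover have "length xs = k" by (simp add: xs_def)
    ultimately show "\<exists>xs. distinct xs \<and> length xs = k \<and> pt \<in> set xs \<and> set xs \<subseteq> {..<3} \<times> V \<and>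
        {e \<in> f i. e \<inter> set xs \<noteq> {}} = cycle_edges xs" by blast
  qed
  \<comment> \<open>As \<open>x\<close> is 1 or -1, the residues of \<open>x\<close> and
    \<open>- x\<close> differ: an edge has only one sign, and sign and colour together determine its
    factor.\<close>
  have x_mod: "(d - x u v) mod 3 \<noteq> 0 \<or> (d + x u v) mod 3 \<noteq> 0" if "R u v" for u v d
    using x_unit[OF that] by presburger
  have uniq: "i = j" if "i < r" "j < r" "Q i p q" "Q j p q" for i j p q
  proof -
    have "i = j" if "Suc i mod r = Suc j mod r"
      using that \<open>i < r\<close> \<open>j < r\<close> by (auto simp: mod_Suc split: if_splits)
    moreover have R: "R (snd p) (snd q)" using that by (auto simp: Q_def S_def)
    ultimately show ?thesis
      using that(3,4) x_mod[OF R, of "int (fst q) - int (fst p)"] unfolding Q_def S_def by auto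
  qed
  have "disjoint_family_on f {..<r}" unfolding disjoint_family_on_def
  proof (intro ballI impI)
    fix i j assume "i \<in> {..<r}" "j \<in> {..<r}" "i \<noteq> j"
    then have False if "e \<in> f i" "e \<in> f j" for e
      using that uniq in_f unfolding f_def by (smt (verit) mem_Collect_eq lessThan_iff in_f f_def)
    then show "f i \<inter> f j = {}" by blast
  qed
  moreover have "triple_edges R = (\<Union>i<r. f i)"
  proof (intro equalityI subsetI)
    fix e assume "e \<in> triple_edges R"
    then obtain a b u v where e: "e = {(a, u), (b, v)}" "a < 3" "b < 3" "a \<noteq> b" "R u v"
      unfolding triple_edges_def by auto
    define c where "c = col u v"
    have c: "c < r" using col_less e c_def by simp
    \<comment> \<open>The cyclic predecessor of \<open>c\<close>: over colour \<open>c\<close> the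
      voltage \<open>x\<close> occurs in factor \<open>c\<close> and \<open>- x\<close> in factor
      \<open>c'\<close>.\<close>
    define c' where "c' = (if c = 0 then r - 1 else c - 1)"
    have c': "c' < r" "Suc c' mod r = c" using c by (auto simp: c'_def)
    have "(int b - int a - x u v) mod 3 = 0 \<or> (int b - int a + x u v) mod 3 = 0"
      using x_unit[OF e(5)] e(2-4) by presburger
    then have "Q c (a, u) (b, v) \<or> Q c' (a, u) (b, v)"
      using e c' unfolding Q_def S_def by (auto simp: c_def)
    then show "e \<in> (\<Union>i<r. f i)" using c c' e in_f by blast
  next
    fix e assume "e \<in> (\<Union>i<r. f i)"
    then obtain i p q where "e = {p, q}" "Q i p q" unfolding f_def by auto
    then obtain a u b v where e: "e = {(a, u), (b, v)}" "Q i (a, u) (b, v)"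
      by (metis surj_pair)
    then have R: "R u v" "a < 3" "b < 3" by (auto simp: Q_def S_def)
    have "a \<noteq> b"
      using e(2) x_unit[OF R(1)] by (auto simp: Q_def S_def)
    then show "e \<in> triple_edges R" using e R unfolding triple_edges_def by blast
  qed
  ultimately show ?thesis unfolding resolvable_def using cover by blast
qed

section \<open>Complete bipartite graphs\<close>

text \<open>Two signs can give 0, 2 and -2, which are all the residues; each further sign is set to
  1 and shifts the target.\<close>

lemma ex_signs_sum_mod_3:
  assumes "n \<ge> 2"
  shows "\<exists>f :: nat \<Rightarrow> int. (\<forall>t. f t = 1 \<or> f t = - 1) \<and> (\<Sum>t<n. f t) mod 3 = c mod 3"
  using assms
proof (induction n arbitrary: c rule: dec_induct)
  case base
  have "c mod 3 = 0 \<or> c mod 3 = 1 \<or> c mod 3 = 2" by presburger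
  then show ?case
  proof (elim disjE)
    assume "c mod 3 = 0"
    then show ?thesis by (intro exI[of _ "\<lambda>t. if t = 0 then 1 else - 1"]) (simp add: numeral_2_eq_2)
  next
    assume "c mod 3 = 1"
    then show ?thesis by (intro exI[of _ "\<lambda>t. - 1"]) (simp add: numeral_2_eq_2)
  next
    assume "c mod 3 = 2"
    then show ?thesis by (intro exI[of _ "\<lambda>t. 1"]) (simp add: numeral_2_eq_2)
  qed
next
  case (step n)
  obtain f :: "nat \<Rightarrow> int" where f: "\<forall>t. f t = 1 \<or> f t = - 1" "(\<Sum>t<n. f t) mod 3 = (c - 1) mod 3"
    using step.IH by blast
  have "(\<Sum>t<n. (f(n := 1)) t) = (\<Sum>t<n. f t)" by (intro sum.cong) auto
  then have "(\<Sum>t<Suc n. (f(n := 1)) t) mod 3 = c mod 3" using f(2) by simp presburger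
  then show ?case using f(1) by (intro exI[of _ "f(n := 1)"]) auto
qed

text \<open>Prescribing the first sign leaves at least two free ones, enough for every
  residue.\<close>

lemma ex_signs_sum_mod_3_first:
  assumes "n \<ge> 3" "s = 1 \<or> s = - 1"
  shows "\<exists>f :: nat \<Rightarrow> int. (\<forall>t. f t = 1 \<or> f t = - 1) \<and> f 0 = s \<and> (\<Sum>t<n. f t) mod 3 = c mod 3"
proof -
  obtain n' where n: "n = Suc n'" "n' \<ge> 2" using assms(1) by (cases n) auto
  obtain f :: "nat \<Rightarrow> int" where f: "\<forall>t. f t = 1 \<or> f t = - 1" "(\<Sum>t<n'. f t) mod 3 = (c - s) mod 3"
    using ex_signs_sum_mod_3[OF n(2)] by blast
  define g where "g t = (case t of 0 \<Rightarrow> s | Suc t \<Rightarrow> f t)" for t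
  have "(\<Sum>t<n. g t) = s + (\<Sum>t<n'. f t)" by (simp add: n sum.lessThan_Suc_shift g_def del: sum.lessThan_Suc)
  then have "(\<Sum>t<n. g t) mod 3 = c mod 3" using f(2) by simp presburger
  moreover have "\<forall>t. g t = 1 \<or> g t = - 1" using f(1) assms(2) by (auto simp: g_def split: nat.split)
  moreover have "g 0 = s" by (simp add: g_def)
  ultimately show ?thesis by blast
qed

lemma sum_lessThan_double:
  fixes h :: "nat \<Rightarrow> 'a::comm_monoid_add"
  shows "(\<Sum>l<2 * m. h l) = (\<Sum>t<m. h (2 * t) + h (2 * t + 1))"
  by (induction m) (simp_all add: ac_simps)

lemma bij_betw_self_if_inj_on:
  assumes "finite A" "inj_on f A" "f ` A \<subseteq> A"
  shows "bij_betw f A A"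
  using assms by (simp add: bij_betw_def endo_inj_surj)

lemma mod_nat_eq_imp_eq:
  fixes a b m :: nat
  assumes "a mod m = b mod m" "a < b + m" "b < a + m"
  shows "a = b"
proof (cases "a \<le> b")
  case True
  then have "m dvd b - a" using assms by (metis mod_eq_dvd_iff_nat)
  then show ?thesis using True assms nat_dvd_not_less[of "b - a" m] by (cases "b - a = 0") auto
next
  case False
  then have "m dvd a - b" using assms by (metis mod_eq_dvd_iff_nat nat_le_linear)
  then show ?thesis using False assms nat_dvd_not_less[of "a - b" m] by (cases "a - b = 0") auto
qed

text \<open>Colours are differences, upper minus lower end, modulo \<open>m\<close>. Cycle
  \<open>i\<close> visits upper \<open>i\<close>, lower 0, upper \<open>i + 1\<close>, lower 1, and
  so on, so these differences alternate between \<open>i\<close> and \<open>i + 1\<close>.\<close>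

lemma resolvable_triple_bipartite:
  assumes m: "m \<ge> 2"
  shows "resolvable (2 * m) ({..<3} \<times> {..<2 * m})
    (triple_edges (\<lambda>u v. u < 2 * m \<and> v < 2 * m \<and> (u < m) \<noteq> (v < m))) m"
proof -
  \<comment> \<open>\<open>y u\<close> becomes the voltage of all edges leaving the lower vertex
    \<open>u\<close>. In each cycle both edges at \<open>u\<close> contribute \<open>- y u\<close>,
    so the signed total is -2 times the sum of \<open>y\<close>, whatever \<open>i\<close>
    is.\<close>
  obtain y :: "nat \<Rightarrow> int" where y: "\<And>t. y t = 1 \<or> y t = - 1" "(\<Sum>t<m. y t) mod 3 = 0"
    using ex_signs_sum_mod_3[OF m, of 0] by (metis mod_0)
  define col where "col u v = (if u < m then (v - u) mod m else (u - v) mod m)" for u v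
  define x where "x u v = (if u < m then y u else - y v)" for u v
  define w where "w i l = (if even l then m + (i + l div 2) mod m else l div 2)" for i l
  have w_even: "w i (2 * t) = m + (i + t) mod m" and w_odd: "w i (Suc (2 * t)) = t"
    and w_even': "w i (Suc (Suc (2 * t))) = m + (i + Suc t) mod m" for i t
    by (simp_all add: w_def)
  have sub: "(m + (i + t) mod m - t) mod m = i" "(m + (i + Suc t) mod m - t) mod m = Suc i mod m"
    if "i < m" "t < m" for i t
  proof -
    have "(i + t) mod m = (if i + t < m then i + t else i + t - m)" using that by (simp add: mod_if)
    then show "(m + (i + t) mod m - t) mod m = i" using that by auto
    have "(i + Suc t) mod m = (if i + Suc t < m then i + Suc t else i + Suc t - m)"
      using that by (simp add: mod_if)
    moreover have "m + (i + Suc t) - t = m + Suc i" "m + (i + Suc t - m) - t = Suc i" if "i + Suc t \<ge> m"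
      using that \<open>t < m\<close> by simp_all
    moreover have "m + (i + Suc t) - t = m + Suc i" by simp
    moreover have "(m + Suc i) mod m = Suc i mod m" by (rule mod_add_self1)
    ultimately show "(m + (i + Suc t) mod m - t) mod m = Suc i mod m" by (metis not_le)
  qed
  have "inj_on (w i) {..<2 * m}" for i
  proof (rule inj_onI)
    fix l l' assume l: "l \<in> {..<2 * m}" "l' \<in> {..<2 * m}" and eq: "w i l = w i l'"
    have lt: "l div 2 < m" "l' div 2 < m" using l by auto
    have "even l \<longleftrightarrow> even l'" using eq lt by (auto simp: w_def split: if_splits)
    moreover have "l div 2 = l' div 2"
    proof (cases "even l")
      case True
      then have "(i + l div 2) mod m = (i + l' div 2) mod m" using eq calculation by (simp add: w_def)
      then have "i + l div 2 = i + l' div 2" by (rule mod_nat_eq_imp_eq) (use lt in auto)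
      then show ?thesis by simp
    next
      case False
      then show ?thesis using eq calculation by (simp add: w_def)
    qed
    ultimately show "l = l'" by (metis even_two_times_div_two odd_two_times_div_two_succ)
  qed
  moreover have "w i ` {..<2 * m} \<subseteq> {..<2 * m}" for i using m by (auto simp: w_def)
  ultimately have bij: "bij_betw (w i) {..<2 * m} {..<2 * m}" for i
    by (intro bij_betw_self_if_inj_on) auto
  have step: "w i l < 2 * m \<and> w i (Suc l) < 2 * m \<and> (w i l < m) \<noteq> (w i (Suc l) < m) \<and>
      col (w i l) (w i (Suc l)) = (if even l then i else Suc i mod m) \<and>
      (- 1) ^ l * x (w i l) (w i (Suc l)) = - y (l div 2)"
    if "i < m" "l < 2 * m" for i l
  proof (cases "even l")
    case True
    then obtain t where t: "l = 2 * t" by blast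
    then show ?thesis using that sub[of i t] by (simp add: w_even w_odd col_def x_def)
  next
    case False
    then obtain t where t: "l = 2 * t + 1" by (blast elim: oddE)
    then show ?thesis using that sub[of i t] by (simp add: w_even' w_odd col_def x_def)
  qed
  have sum: "(\<Sum>l<2 * m. (- 1) ^ l * x (w i l) (w i (Suc l))) mod 3 = 0" if "i < m" for i
  proof -
    have "(\<Sum>l<2 * m. (- 1) ^ l * x (w i l) (w i (Suc l))) = (\<Sum>l<2 * m. - y (l div 2))"
      using step[OF that] by (intro sum.cong) auto
    also have "\<dots> = - 2 * (\<Sum>t<m. y t)"
      by (simp add: sum_lessThan_double sum_distrib_left flip: sum_negf)
    finally show ?thesis using y(2) by presburger
  qed
  show ?thesis
  proof (rule resolvable_voltage_lift[where col = col and x = x and w = w])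
    fix u v v' assume u: "u < 2 * m \<and> v < 2 * m \<and> (u < m) \<noteq> (v < m)"
      "u < 2 * m \<and> v' < 2 * m \<and> (u < m) \<noteq> (v' < m)" and c: "col u v = col u v'"
    show "v = v'"
    proof (cases "u < m")
      case True
      then have "(v - u) mod m = (v' - u) mod m" using c by (simp add: col_def)
      then have "v - u = v' - u" by (rule mod_nat_eq_imp_eq) (use True u in auto)
      then show ?thesis using True u by auto
    next
      case False
      then have "(u - v) mod m = (u - v') mod m" using c by (simp add: col_def)
      then have "u - v = u - v'" by (rule mod_nat_eq_imp_eq) (use False u in auto)
      then show ?thesis using False u by auto
    qed
  next
    fix i assume "i < m"
    then show "w i (2 * m) = w i 0" by (simp add: w_def)
  next
    fix i l assume "i < m" "l < 2 * m"
    from step[OF this] show "w i l < 2 * m \<and> w i (Suc l) < 2 * m \<and> (w i l < m) \<noteq> (w i (Suc l) < m)"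
      "col (w i l) (w i (Suc l)) = (if even l then i else Suc i mod m)" by simp_all
  qed (use m y(1) bij sum in \<open>auto simp: col_def x_def\<close>)
qed

section \<open>Complete graphs\<close>

text \<open>The round-robin colouring of the complete graph on the residues mod N and a point at
  infinity, which is represented by N.\<close>

definition rr_col :: "nat \<Rightarrow> nat \<Rightarrow> nat \<Rightarrow> nat" where
  "rr_col N u v = (if u = N then 2 * v else if v = N then 2 * u else u + v) mod N"

lemma rr_col_commute: "rr_col N v u = rr_col N u v"
  by (simp add: rr_col_def add.commute)

text \<open>The edge from a finite \<open>u\<close> to infinity has the colour that the sum rule
  would give to v = u, so cancelling \<open>u\<close> settles all finite \<open>u\<close>. At
  infinity, 2 is invertible modulo the odd \<open>N\<close>.\<close>

lemma rr_col_proper: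
  assumes N: "odd N" and le: "u \<le> N" "v \<le> N" "v' \<le> N" and ne: "u \<noteq> v" "u \<noteq> v'"
    and eq: "rr_col N u v = rr_col N u v'"
  shows "v = v'"
proof -
  have N0: "N > 0" using N by (rule odd_pos)
  consider "u = N" | "u < N" "v = N" "v' = N" | "u < N" "v = N" "v' < N" | "u < N" "v < N" "v' = N"
    | "u < N" "v < N" "v' < N" using le by linarith
  then show ?thesis
  proof cases
    case 1
    then have "2 * v mod N = 2 * v' mod N" using eq by (simp add: rr_col_def)
    then have "int N dvd 2 * (int v - int v')"
      by (metis int_ops(7) mod_eq_dvd_iff of_nat_mod of_nat_numeral right_diff_distrib')
    moreover have "coprime (int N) 2" using N by simp
    ultimately have "int N dvd int v - int v'" using coprime_dvd_mult_right_iff by blast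
    then have "v mod N = v' mod N" by (metis mod_eq_dvd_iff nat_int of_nat_mod)
    then show ?thesis using 1 le ne by simp
  next
    case 3
    then have "(u + u) mod N = (u + v') mod N" using eq by (simp add: rr_col_def mult_2)
    then have "u + u = u + v'" by (rule mod_nat_eq_imp_eq) (use 3 in auto)
    then show ?thesis using ne by simp
  next
    case 4
    then have "(u + v) mod N = (u + u) mod N" using eq by (simp add: rr_col_def mult_2)
    then have "u + v = u + u" by (rule mod_nat_eq_imp_eq) (use 4 in auto)
    then show ?thesis using ne by simp
  next
    case 5
    then have "(u + v) mod N = (u + v') mod N" using eq by (simp add: rr_col_def)
    then have "u + v = u + v'" by (rule mod_nat_eq_imp_eq) (use 5 in auto)
    then show ?thesis by simp
  qed simp
qed

text \<open>A finite \<open>u\<close> has the partner c - u, replaced by infinity if that is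
  \<open>u\<close> itself; infinity has the partner c / 2, where \<open>M + 1\<close> is the inverse
  of 2. With properness, every colour class is a 1-factor.\<close>

lemma rr_col_perfect:
  assumes N: "odd N" and u: "u \<le> N" and c: "c < N"
  shows "\<exists>v\<le>N. v \<noteq> u \<and> rr_col N u v = c"
proof (cases "u = N")
  case True
  obtain M where M: "N = 2 * M + 1" using N by (blast elim: oddE)
  have "2 * (c * (M + 1) mod N) mod N = 2 * (c * (M + 1)) mod N" by (rule mod_mult_right_eq)
  also have "2 * (c * (M + 1)) = c + N * c" by (simp add: M algebra_simps)
  finally have "rr_col N u (c * (M + 1) mod N) = c" using True c by (simp add: rr_col_def)
  moreover have "c * (M + 1) mod N < N" using c by simp
  ultimately show ?thesis using True by (intro exI[of _ "c * (M + 1) mod N"]) auto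
next
  case False
  define v where "v = (c + (N - u)) mod N"
  have v: "v < N" using c by (simp add: v_def)
  have "(u + v) mod N = (u + (c + (N - u))) mod N" unfolding v_def by (rule mod_add_right_eq)
  also have "u + (c + (N - u)) = c + N" using u by simp
  finally have uv: "(u + v) mod N = c" using c by simp
  show ?thesis
  proof (cases "v = u")
    case True
    then show ?thesis using False uv by (intro exI[of _ N]) (auto simp: rr_col_def mult_2)
  next
    case neq: False
    then show ?thesis using False uv v by (intro exI[of _ v]) (auto simp: rr_col_def)
  qed
qed

text \<open>Writing \<open>T i\<close> for the residue of the i-th sum, and choosing \<open>U (i + 1) 0 = T i - T (i + 1)\<close>, the
  condition becomes \<open>3 * (T i - T (i + 1)) = 0\<close>; it remains that \<open>T\<close> is a proper 3-colouring of the
  N-cycle.\<close>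

lemma ex_round_robin_voltages:
  assumes N: "odd N" "N \<ge> 3" and m: "m \<ge> 3"
  shows "\<exists>U :: nat \<Rightarrow> nat \<Rightarrow> int. (\<forall>c t. U c t = 1 \<or> U c t = - 1) \<and>
    (\<forall>i<N. ((\<Sum>t<m. U i t) - (\<Sum>t<m. U (Suc i mod N) t) + 2 * U (Suc i mod N) 0) mod 3 = 0)"
proof -
  \<comment> \<open>As \<open>N\<close> is odd, alternating 0 and 1 would clash at the wrap-around;
    the last index takes the third colour.\<close>
  define T :: "nat \<Rightarrow> int" where "T i = (if i = N - 1 then 2 else int (i mod 2))" for i
  \<comment> \<open>For \<open>c < N\<close> this is the sign congruent to
    \<open>T (c - 1) - T c\<close>, the index \<open>c - 1\<close> being read cyclically.\<close>
  define s :: "nat \<Rightarrow> int" where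
    "s c = (if (T (if c = 0 then N - 1 else c - 1) - T c) mod 3 = 1 then 1 else - 1)" for c
  have s: "(s (Suc i mod N) - (T i - T (Suc i mod N))) mod 3 = 0" if i: "i < N" for i
  proof (cases "Suc i = N")
    case True
    then show ?thesis using N by (auto simp: s_def T_def)
  next
    case False
    then have lt: "Suc i < N" using i by simp
    have sSuc: "s (Suc i) = (if (T i - T (Suc i)) mod 3 = 1 then 1 else - 1)" by (simp add: s_def)
    have Ti: "T i = int (i mod 2)" using False i by (simp add: T_def)
    consider "i mod 2 = 1" "T (Suc i) = 2" | "i mod 2 = 1" "T (Suc i) = 0" | "i mod 2 = 0" "T (Suc i) = 1"
    proof (cases "Suc (Suc i) = N")
      case True
      then have "i mod 2 = 1" using N(1) by presburger
      then show ?thesis using True that(1) by (simp add: T_def)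
    next
      case False
      then have "T (Suc i) = int (Suc i mod 2)" using lt by (simp add: T_def)
      moreover have "i mod 2 = 0 \<and> Suc i mod 2 = 1 \<or> i mod 2 = 1 \<and> Suc i mod 2 = 0" by presburger
      ultimately show ?thesis using that(2,3) by fastforce
    qed
    then show ?thesis using lt by cases (simp_all add: sSuc Ti)
  qed
  have "\<forall>c. \<exists>f :: nat \<Rightarrow> int. (\<forall>t. f t = 1 \<or> f t = - 1) \<and> f 0 = s c \<and> (\<Sum>t<m. f t) mod 3 = T c mod 3"
    by (intro allI ex_signs_sum_mod_3_first m) (simp add: s_def)
  then obtain U :: "nat \<Rightarrow> nat \<Rightarrow> int" where U: "\<And>c t. U c t = 1 \<or> U c t = - 1" "\<And>c. U c 0 = s c"
      "\<And>c. (\<Sum>t<m. U c t) mod 3 = T c mod 3"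
    by metis
  have lin: "(A - B + 2 * d) mod 3 = 0" if "(d - (a - b)) mod 3 = 0" "A mod 3 = a mod 3" "B mod 3 = b mod 3"
    for A B a b d :: int
    using that by presburger
  have "((\<Sum>t<m. U i t) - (\<Sum>t<m. U (Suc i mod N) t) + 2 * U (Suc i mod N) 0) mod 3 = 0" if "i < N" for i
    using lin[OF s[OF that] U(3) U(3)] unfolding U(2) .
  then show ?thesis using U(1) by blast
qed

text \<open>On the residues, colours \<open>i\<close> and \<open>i + 1\<close> are the reflections
  of v to i - v and to i + 1 - v. Alternating them translates by 1, so together they form one cycle
  through infinity and all residues.\<close>

lemma resolvable_triple_complete:
  assumes m: "m \<ge> 3"
  shows "resolvable (2 * m) ({..<3} \<times> {..<2 * m})
    (triple_edges (\<lambda>u v. u < 2 * m \<and> v < 2 * m \<and> u \<noteq> v)) (2 * m - 1)"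
proof -
  define N where "N = 2 * m - 1"
  have N: "odd N" "N \<ge> 3" "2 * m = Suc N" using m by (auto simp: N_def)
  have iN: "int N = 2 * int m - 1" using N(3) by linarith
  obtain U :: "nat \<Rightarrow> nat \<Rightarrow> int" where U: "\<And>c t. U c t = 1 \<or> U c t = - 1"
    and Usum: "\<And>i. i < N \<Longrightarrow>
      ((\<Sum>t<m. U i t) - (\<Sum>t<m. U (Suc i mod N) t) + 2 * U (Suc i mod N) 0) mod 3 = 0"
    using ex_round_robin_voltages[OF N(1,2) m] by blast
  \<comment> \<open>Since m is the inverse of 2 mod N, the class of colour i consists of the edges from i * m + t to
    i * m - t, and \<open>\<tau>\<close> recovers t. The i-th cycle visits infinity, c, c + 1, c - 1, c + 2, ...
    with c = i * m.\<close>
  define \<tau> where "\<tau> u v = nat (((int u - int v) * int m) mod int N)" for u v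
  \<comment> \<open>The positive direction leads away from infinity, or from
    \<open>i * m + t\<close> to \<open>i * m - t\<close> with \<open>0 < t < m\<close>. Reversal
    turns \<open>\<tau>\<close> into \<open>N - \<tau>\<close>, which is then at least
    \<open>m\<close>.\<close>
  define x where "x u v =
    (if u = N then U (rr_col N u v) 0 else if v = N then - U (rr_col N u v) 0
     else if \<tau> u v < m then U (rr_col N u v) (\<tau> u v) else - U (rr_col N u v) (N - \<tau> u v))" for u v
  define p where "p i \<delta> = nat ((int (i * m) + \<delta>) mod int N)" for i \<delta>
  define w where "w i l = (if l mod (2 * m) = 0 then N
    else p i (if even l then int (l div 2) else - int (l div 2)))" for i l
  have p_less: "p i \<delta> < N" for i \<delta> using N by (simp add: p_def nat_less_iff)
  have int_p: "int (p i \<delta>) = (int (i * m) + \<delta>) mod int N" for i \<delta> using N by (simp add: p_def)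
  have p_inj: "\<delta> = \<delta>'" if eq: "p i \<delta> = p i \<delta>'" and "\<bar>\<delta> - \<delta>'\<bar> < int N" for i \<delta> \<delta>'
  proof -
    have "(int (i * m) + \<delta>) mod int N = (int (i * m) + \<delta>') mod int N" using eq int_p by metis
    then have "int N dvd \<delta> - \<delta>'" by (simp add: mod_eq_dvd_iff)
    then show ?thesis using that(2) by (metis dvd_imp_le_int abs_of_nat eq_iff_diff_eq_0 not_le)
  qed
  have two_im: "(2 * int (i * m) + d) mod int N = (int i + d) mod int N" for i d
  proof -
    have "2 * int (i * m) + d = int i + d + int N * int i" by (simp add: iN algebra_simps)
    then show ?thesis by (simp only: mod_mult_self2)
  qed
  have col_p: "int (rr_col N (p i \<delta>) (p i \<delta>')) = (int i + \<delta> + \<delta>') mod int N" for i \<delta> \<delta>'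
  proof -
    have "int (rr_col N (p i \<delta>) (p i \<delta>')) = (int (p i \<delta>) + int (p i \<delta>')) mod int N"
      using p_less[of i \<delta>] p_less[of i \<delta>'] by (simp add: rr_col_def zmod_int)
    also have "\<dots> = (2 * int (i * m) + (\<delta> + \<delta>')) mod int N"
      unfolding int_p mod_add_eq by (rule arg_cong[where f = "\<lambda>z. z mod int N"]) simp
    finally show ?thesis unfolding two_im by (simp add: add.assoc)
  qed
  have col_inf: "int (rr_col N N (p i \<delta>)) = (int i + 2 * \<delta>) mod int N" for i \<delta>
  proof -
    have "int (rr_col N N (p i \<delta>)) = (2 * int (p i \<delta>)) mod int N"
      by (simp add: rr_col_def zmod_int)
    also have "\<dots> = (2 * int (i * m) + 2 * \<delta>) mod int N"
      unfolding int_p mod_mult_right_eq by (simp only: distrib_left)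
    finally show ?thesis unfolding two_im .
  qed
  have \<tau>_p: "\<tau> (p i \<delta>) (p i \<delta>') = nat (((\<delta> - \<delta>') * int m) mod int N)" for i \<delta> \<delta>'
  proof -
    have "((int (p i \<delta>) - int (p i \<delta>')) * int m) mod int N = ((\<delta> - \<delta>') * int m) mod int N"
      unfolding int_p by (metis (no_types, lifting) add_diff_cancel_left mod_diff_eq mod_mult_left_eq)
    then show ?thesis by (simp add: \<tau>_def)
  qed
  have w0: "w i 0 = N" and wm: "w i (2 * m) = N" for i by (simp_all add: w_def)
  have w_even: "w i (2 * t) = p i (int t)" if "0 < t" "t < m" for i t
    using that by (simp add: w_def)
  have w_odd: "w i (Suc (2 * t)) = p i (- int t)" if "t < m" for i t
    using that by (simp add: w_def mod_less)
  have "inj_on (w i) {..<2 * m}" for i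
  proof (rule inj_onI)
    fix l l' assume l: "l \<in> {..<2 * m}" "l' \<in> {..<2 * m}" and eq: "w i l = w i l'"
    show "l = l'"
    proof (cases "l = 0 \<or> l' = 0")
      case True
      then show ?thesis using eq l p_less by (auto simp: w_def split: if_splits)
    next
      case False
      define \<delta> where "\<delta> l = (if even l then int (l div 2) else - int (l div 2))" for l
      have "p i (\<delta> l) = p i (\<delta> l')" using eq False l by (simp add: w_def \<delta>_def)
      moreover have "l div 2 < m" "l' div 2 < m" using l by auto
      then have "\<bar>\<delta> l - \<delta> l'\<bar> < int N" using iN by (auto simp: \<delta>_def)
      ultimately have "\<delta> l = \<delta> l'" by (rule p_inj)
      then show ?thesis using False unfolding \<delta>_def by (auto split: if_splits) presburger+
    qed
  qed
  moreover have "w i ` {..<2 * m} \<subseteq> {..<2 * m}" for i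
    using p_less N(3) by (auto simp: w_def less_Suc_eq)
  ultimately have bij: "bij_betw (w i) {..<2 * m} {..<2 * m}" for i
    by (intro bij_betw_self_if_inj_on) auto
  have wSuc_ne: "w i l \<noteq> w i (Suc l)" if "l < 2 * m" for i l
  proof (cases "Suc l = 2 * m")
    case True
    then show ?thesis using p_less wm[of i] m by (auto simp: w_def)
  next
    case False
    then have "Suc l < 2 * m" using that by simp
    then show ?thesis using inj_onD[OF bij_betw_imp_inj_on[OF bij[of i]], of l "Suc l"] that by auto
  qed
  have w_le: "w i l < 2 * m" for i l using p_less[of i] N(3) by (auto simp: w_def less_Suc_eq)
  have even_step: "rr_col N (w i (2 * t)) (w i (Suc (2 * t))) = i \<and> x (w i (2 * t)) (w i (Suc (2 * t))) = U i t"
    if "i < N" "t < m" for i t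
  proof (cases "t = 0")
    case True
    have "int (rr_col N N (p i 0)) = int i" using col_inf[of i 0] that by simp
    then show ?thesis using True that m by (simp add: w0 w_odd[of 0, simplified] x_def)
  next
    case False
    have c: "int (rr_col N (p i (int t)) (p i (- int t))) = int i" using col_p that by simp
    have "(int t - (- int t)) * int m = int t + int N * int t" by (simp add: iN algebra_simps)
    then have "\<tau> (p i (int t)) (p i (- int t)) = t" using that iN unfolding \<tau>_p by simp
    then show ?thesis using c False that p_less by (simp add: w_even w_odd x_def less_imp_neq)
  qed
  have odd_step: "rr_col N (w i (Suc (2 * t))) (w i (Suc (Suc (2 * t)))) = Suc i mod N \<and>
      x (w i (Suc (2 * t))) (w i (Suc (Suc (2 * t)))) =
        (if m - Suc t = 0 then - U (Suc i mod N) 0 else U (Suc i mod N) (m - Suc t))"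
    if "i < N" "t < m" for i t
  proof (cases "Suc t = m")
    case True
    then have e: "Suc (Suc (2 * t)) = 2 * m" by simp
    \<comment> \<open>The last finite vertex has offset \<open>- (m - 1)\<close>, and
      \<open>- 2 * (m - 1)\<close> is 1 modulo \<open>N\<close>: its edge to infinity has colour
      \<open>i + 1\<close>.\<close>
    have "int i + 2 * (- int t) = int (Suc i) + int N * (- 1)" using True iN by simp
    then have "int (rr_col N N (p i (- int t))) = int (Suc i mod N)"
      by (simp only: col_inf mod_mult_self2 zmod_int)
    then have "rr_col N (p i (- int t)) N = Suc i mod N" by (simp add: rr_col_commute)
    then show ?thesis unfolding e using True that p_less by (simp add: wm w_odd x_def less_imp_neq)
  next
    case False
    have "w i (Suc (Suc (2 * t))) = p i (int (Suc t))" using w_even[of "Suc t" i] False that by simp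
    moreover have "int (rr_col N (p i (- int t)) (p i (int (Suc t)))) = int (Suc i mod N)"
      using col_p[of i "- int t" "int (Suc t)"] by (simp add: zmod_int add.commute)
    \<comment> \<open>Measured from the centre \<open>(i + 1) * m\<close> of the next colour, this
      vertex has offset \<open>m - 1 - t\<close>.\<close>
    moreover have "(- int t - int (Suc t)) * int m = int (m - Suc t) + int N * (- int t - 1)"
      using that by (simp add: iN algebra_simps of_nat_diff)
    then have "\<tau> (p i (- int t)) (p i (int (Suc t))) = m - Suc t"
      using that iN unfolding \<tau>_p by (simp del: of_nat_Suc)
    ultimately show ?thesis using False that p_less by (simp add: w_odd x_def less_imp_neq)
  qed
  have sum: "(\<Sum>l<2 * m. (- 1) ^ l * x (w i l) (w i (Suc l))) mod 3 = 0" if i: "i < N" for i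
  proof -
    let ?c = "Suc i mod N"
    let ?g = "\<lambda>s. if s = 0 then - U ?c 0 else U ?c s"
    have "(\<Sum>l<2 * m. (- 1) ^ l * x (w i l) (w i (Suc l))) = (\<Sum>t<m. U i t - ?g (m - Suc t))"
      unfolding sum_lessThan_double using even_step[OF i] odd_step[OF i] by (intro sum.cong) auto
    also have "\<dots> = (\<Sum>t<m. U i t) - (\<Sum>t<m. ?g t)"
      using sum.nat_diff_reindex[of ?g m] by (simp only: sum_subtractf)
    \<comment> \<open>Only the edge into infinity is traversed against its positive direction;
      separating it yields the correction \<open>2 * U ?c 0\<close>.\<close>
    also have "(\<Sum>t<m. ?g t) = (\<Sum>t<m. U ?c t - (if t = 0 then 2 * U ?c 0 else 0))"
      by (intro sum.cong) auto
    also have "\<dots> = (\<Sum>t<m. U ?c t) - 2 * U ?c 0"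
      using m by (simp add: sum_subtractf sum.delta)
    finally show ?thesis using Usum[OF i] by (simp only: diff_diff_eq2 diff_add_eq)
  qed
  have col: "rr_col N (w i l) (w i (Suc l)) = (if even l then i else Suc i mod N)" if "i < N" "l < 2 * m" for i l
  proof (cases "even l")
    case True
    then show ?thesis using that even_step by (auto elim!: evenE)
  next
    case False
    then show ?thesis using that odd_step by (auto elim!: oddE)
  qed
  have x_anti: "x v u = - x u v" if uv: "u < 2 * m" "v < 2 * m" "u \<noteq> v" for u v
  proof (cases "u = N \<or> v = N")
    case True
    then show ?thesis using uv by (auto simp: x_def rr_col_commute)
  next
    case False
    then have lt: "u < N" "v < N" using uv N(3) by auto
    define z where "z = ((int u - int v) * int m) mod int N"
    \<comment> \<open>Doubling turns the factor \<open>m\<close> into 1 modulo \<open>N\<close>, so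
      \<open>z\<close> could vanish only for equal residues.\<close>
    have "z \<noteq> 0"
    proof
      assume "z = 0"
      then have "int N dvd (int u - int v) * int m" by (simp add: z_def dvd_eq_mod_eq_0)
      then have "int N dvd 2 * ((int u - int v) * int m)" by (rule dvd_mult)
      also have "2 * ((int u - int v) * int m) = (int u - int v) + int N * (int u - int v)"
        by (simp add: iN algebra_simps)
      finally have "int N dvd int u - int v" by (simp add: dvd_add_left_iff)
      then have "u mod N = v mod N" by (metis mod_eq_dvd_iff nat_int of_nat_mod)
      then show False using lt uv by simp
    qed
    moreover have zr: "0 \<le> z" "z < int N" using N by (simp_all add: z_def)
    moreover have "((int v - int u) * int m) mod int N = (- z) mod int N"
      unfolding z_def by (metis minus_diff_eq mod_minus_eq mult_minus_left)
    moreover have "(- z) mod int N = int N - z"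
      using \<open>z \<noteq> 0\<close> zr by (simp add: zmod_zminus1_eq_if)
    ultimately have "\<tau> u v = nat z" "\<tau> v u = N - nat z" "0 < nat z" "nat z < N"
      by (simp_all add: \<tau>_def nat_diff_distrib nat_less_iff flip: z_def)
    then show ?thesis using False N(3) by (auto simp: x_def rr_col_commute)
  qed
  have "resolvable (2 * m) ({..<3} \<times> {..<2 * m})
    (triple_edges (\<lambda>u v. u < 2 * m \<and> v < 2 * m \<and> u \<noteq> v)) N"
  proof (rule resolvable_voltage_lift[where col = "rr_col N" and x = x and w = w])
    fix u v v' assume "u < 2 * m \<and> v < 2 * m \<and> u \<noteq> v"
      "u < 2 * m \<and> v' < 2 * m \<and> u \<noteq> v'" and "rr_col N u v = rr_col N u v'"
    then show "v = v'" using N(3) by (intro rr_col_proper[OF N(1), of u v v']) auto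
  next
    fix u v assume uv: "u < 2 * m \<and> v < 2 * m \<and> u \<noteq> v"
    then show "x v u = - x u v" using x_anti by blast
    from uv show "x u v = 1 \<or> x u v = - 1" using U by (simp add: x_def) (metis minus_minus)
    show "rr_col N u v < N" using N by (simp add: rr_col_def)
  next
    fix i assume "i < N"
    then show "(\<Sum>l<2 * m. (- 1) ^ l * x (w i l) (w i (Suc l))) mod 3 = 0" by (rule sum)
  next
    fix i l assume "i < N" "l < 2 * m"
    then show "rr_col N (w i l) (w i (Suc l)) = (if even l then i else Suc i mod N)" by (rule col)
  qed (use m x_anti wSuc_ne w_le bij in \<open>auto simp: rr_col_commute w0 wm\<close>)
  then show ?thesis by (simp add: N_def)
qed

section \<open>Assembling the groups\<close>

lemma edges_tensor_complete:
  "edges (tensor_product (complete_graph 3) (complete_graph n)) =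
    triple_edges (\<lambda>u v. u < n \<and> v < n \<and> u \<noteq> v)"
  unfolding tensor_product_def triple_edges_def complete_graph_adjacent_iff by auto

lemma triple_edges_Union:
  "triple_edges (\<lambda>u v. \<exists>j\<in>J. R j u v) = (\<Union>j\<in>J. triple_edges (R j))"
  unfolding triple_edges_def by blast

lemma triple_edges_disjoint:
  assumes "\<And>u v. R u v \<Longrightarrow> R v u" "\<And>u v. R u v \<Longrightarrow> \<not> R' u v"
  shows "triple_edges R \<inter> triple_edges R' = {}"
  using assms unfolding triple_edges_def by (auto simp: doubleton_eq_iff)

theorem theorem3p6:
  fixes k y :: nat
  assumes "even k" and "k > 6" and "y \<ge> 2"
  shows "\<exists>P. is_cycle_factorization k (tensor_product (complete_graph 3) (complete_graph (k * y))) P"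
proof -
  obtain m where k: "k = 2 * m" using assms(1) by blast
  then have m: "m \<ge> 3" using assms(2) by simp
  \<comment> \<open>The groups are numbered 0 to \<open>N\<close>, with group \<open>N\<close> as
    the point at infinity; the colouring yields \<open>N\<close> 1-factors.\<close>
  define N where "N = 2 * y - 1"
  have N: "odd N" "Suc N = 2 * y" "0 < N" using assms(3) by (auto simp: N_def)
  define n where "n = k * y"
  have n: "n = Suc N * m" using k N(2) by (simp add: n_def)
  define J where "J t = {(g, g'). g < g' \<and> g' \<le> N \<and> rr_col N g g' = t}" for t
  define B where "B g = {v. v div m = g}" for g
  define V where "V j = B (fst j) \<union> B (snd j)" for j
  \<comment> \<open>Edges inside a group go to the 1-factor 0 alone, so that each of them is used
    exactly once.\<close>
  define R where "R t j u v \<longleftrightarrow>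
    u \<in> V j \<and> v \<in> V j \<and> (if t = 0 then u \<noteq> v else u div m \<noteq> v div m)" for t :: nat and j u v
  define h where "h j v = (if v < m then fst j * m + v else snd j * m + (v - m))" for j v
  have local: "resolvable k ({..<3} \<times> V j) (triple_edges (R t j)) (if t = 0 then 2 * m - 1 else m)"
    if "fst j < snd j" for t j
  proof -
    have h_div_mod: "h j v div m = (if v < m then fst j else snd j) \<and> h j v mod m = (if v < m then v else v - m)"
      if "v < 2 * m" for v
    proof -
      have "(g * m + d) div m = g \<and> (g * m + d) mod m = d" if "d < m" for g d
        using that by simp
      moreover have "v < m \<or> v - m < m" using that by linarith
      ultimately show ?thesis unfolding h_def by presburger
    qed
    then have h_div: "h j v div m = (if v < m then fst j else snd j)"
      and h_mod: "h j v mod m = (if v < m then v else v - m)" if "v < 2 * m" for v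
      using that by blast+
    have inj: "inj_on (h j) {..<2 * m}"
    proof (rule inj_onI)
      fix u v assume uv: "u \<in> {..<2 * m}" "v \<in> {..<2 * m}" and "h j u = h j v"
      then have "(if u < m then fst j else snd j) = (if v < m then fst j else snd j)"
        "(if u < m then u else u - m) = (if v < m then v else v - m)"
        using h_div h_mod by (metis lessThan_iff)+
      then show "u = v" using \<open>fst j < snd j\<close> by (auto split: if_splits)
    qed
    have img: "h j ` {..<2 * m} = V j"
    proof (intro equalityI subsetI)
      fix v assume "v \<in> h j ` {..<2 * m}"
      then show "v \<in> V j" using h_div by (auto simp: V_def B_def split: if_splits)
    next
      fix v assume "v \<in> V j"
      then consider "v div m = fst j" | "v div m = snd j" by (auto simp: V_def B_def)
      then show "v \<in> h j ` {..<2 * m}"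
      proof cases
        case 1
        then have "v = h j (v mod m)" using m by (simp add: h_def flip: 1)
        moreover have "v mod m < 2 * m" using m by (simp add: less_le_trans[OF mod_less_divisor])
        ultimately show ?thesis by blast
      next
        case 2
        then have "v = h j (m + v mod m)" using m by (simp add: h_def flip: 2)
        moreover have "m + v mod m < 2 * m" using m by simp
        ultimately show ?thesis by blast
      qed
    qed
    show ?thesis
    proof (cases "t = 0")
      case True
      have "(\<exists>u' v'. u = h j u' \<and> v = h j v' \<and> u' < 2 * m \<and> v' < 2 * m \<and> u' \<noteq> v') \<longleftrightarrow> R t j u v" for u v
        using inj True unfolding R_def img[symmetric] inj_on_def by auto
      then show ?thesis
        using resolvable_triple_image[OF resolvable_triple_complete[OF m] inj] True k img by simp
    next
      case False
      have "(\<exists>u' v'. u = h j u' \<and> v = h j v' \<and> u' < 2 * m \<and> v' < 2 * m \<and> (u' < m) \<noteq> (v' < m)) \<longleftrightarrow> R t j u v"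
        for u v
      proof
        assume "\<exists>u' v'. u = h j u' \<and> v = h j v' \<and> u' < 2 * m \<and> v' < 2 * m \<and> (u' < m) \<noteq> (v' < m)"
        then show "R t j u v"
          using False \<open>fst j < snd j\<close> h_div unfolding R_def img[symmetric] by auto
      next
        assume "R t j u v"
        then obtain u' v' where "u = h j u'" "v = h j v'" "u' < 2 * m" "v' < 2 * m" "u div m \<noteq> v div m"
          using False unfolding R_def img[symmetric] by auto
        then show "\<exists>u' v'. u = h j u' \<and> v = h j v' \<and> u' < 2 * m \<and> v' < 2 * m \<and> (u' < m) \<noteq> (v' < m)"
          using h_div by metis
      qed
      moreover have "m \<ge> 2" using m by simp
      ultimately show ?thesis
        using resolvable_triple_image[OF resolvable_triple_bipartite inj] False k img by simp
    qed
  qed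
  have pair: "\<exists>j\<in>J t. g \<in> {fst j, snd j} \<and> g' \<in> {fst j, snd j}"
    if "g \<le> N" "g' \<le> N" "g \<noteq> g'" "rr_col N g g' = t" for g g' t
  proof (cases "g < g'")
    case True
    then have "(g, g') \<in> J t" using that by (simp add: J_def)
    then show ?thesis by force
  next
    case False
    then have "(g', g) \<in> J t" using that by (simp add: J_def rr_col_commute)
    then show ?thesis by force
  qed
  have J_rr: "rr_col N g g' = t" if "j \<in> J t" "g \<in> {fst j, snd j}" "g' \<in> {fst j, snd j}" "g \<noteq> g'" for j t g g'
    using that by (auto simp: J_def rr_col_commute)
  have div_le: "v div m \<le> N \<longleftrightarrow> v < n" for v
    using m by (simp add: n less_mult_imp_div_less div_less_iff_less_mult flip: less_Suc_eq_le)
  have J_le: "fst j < snd j" "snd j \<le> N" if "j \<in> J t" for j t using that by (auto simp: J_def)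
  have V_iff: "v \<in> V j \<longleftrightarrow> v div m \<in> {fst j, snd j}" for v j by (auto simp: V_def B_def)
  have V_disj: "disjoint_family_on V (J t)" for t
    unfolding disjoint_family_on_def
  proof (intro ballI impI)
    fix j j' assume j: "j \<in> J t" "j' \<in> J t" "j \<noteq> j'"
    have False if "g \<in> {fst j, snd j}" "g \<in> {fst j', snd j'}" for g
    proof -
      \<comment> \<open>\<open>o1\<close> and \<open>o2\<close> are the partners of the shared group
        \<open>g\<close>; properness makes them equal, hence also the pairs.\<close>
      define o1 where "o1 = (if g = fst j then snd j else fst j)"
      define o2 where "o2 = (if g = fst j' then snd j' else fst j')"
      have "rr_col N g o1 = t" "rr_col N g o2 = t" "g \<noteq> o1" "g \<noteq> o2" "g \<le> N" "o1 \<le> N" "o2 \<le> N"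
        using that j J_rr J_le[OF j(1)] J_le[OF j(2)] by (auto simp: o1_def o2_def)
      then have "o1 = o2" using rr_col_proper[OF N(1)] by metis
      then show False
        using that j(3) J_le[OF j(1)] J_le[OF j(2)] by (auto simp: o1_def o2_def prod_eq_iff split: if_splits)
    qed
    then show "V j \<inter> V j' = {}" using V_iff by blast
  qed
  have V_Union: "(\<Union>j\<in>J t. {..<3::nat} \<times> V j) = {..<3} \<times> {..<n}" if t: "t < N" for t
  proof -
    have "(\<Union>j\<in>J t. V j) = {..<n}"
    proof (intro equalityI subsetI)
      fix v assume "v \<in> (\<Union>j\<in>J t. V j)"
      then have "v div m \<le> N" using V_iff J_le by fastforce
      then show "v \<in> {..<n}" using div_le by simp
    next
      fix v assume "v \<in> {..<n}"
      then have v: "v div m \<le> N" using div_le by simp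
      then obtain g' where "g' \<le> N" "g' \<noteq> v div m" "rr_col N (v div m) g' = t"
        using rr_col_perfect[OF N(1) _ t] by blast
      then obtain j where "j \<in> J t" "v div m \<in> {fst j, snd j}" using pair[OF v] by metis
      then show "v \<in> (\<Union>j\<in>J t. V j)" using V_iff by blast
    qed
    then show ?thesis by blast
  qed
  have res: "resolvable k ({..<3} \<times> {..<n}) (\<Union>j\<in>J t. triple_edges (R t j))
      (if t = 0 then 2 * m - 1 else m)" if t: "t < N" for t
  proof -
    have "disjoint_family_on (\<lambda>j. {..<3::nat} \<times> V j) (J t)"
      using V_disj[of t] unfolding disjoint_family_on_def by blast
    then have "resolvable k (\<Union>j\<in>J t. {..<3} \<times> V j) (\<Union>j\<in>J t. triple_edges (R t j))
        (if t = 0 then 2 * m - 1 else m)"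
      by (intro resolvable_disjoint_Union local J_le(1))
    then show ?thesis unfolding V_Union[OF t] .
  qed
  define Q where "Q t u v \<longleftrightarrow> (\<exists>j\<in>J t. R t j u v)" for t u v
  \<comment> \<open>The ends of an edge determine \<open>t\<close>: it is the colour of their
    groups, or 0 inside a group. This gives disjointness for different \<open>t\<close>.\<close>
  have Q_col: "u div m \<noteq> v div m \<and> rr_col N (u div m) (v div m) = t \<or> u div m = v div m \<and> t = 0"
    if "Q t u v" for t u v
    using that J_rr unfolding Q_def R_def V_iff by (metis (full_types))
  have Q_sym: "Q t v u" if "Q t u v" for t u v using that unfolding Q_def R_def by metis
  have "disjoint_family_on (\<lambda>t. triple_edges (Q t)) {..<N}"
    unfolding disjoint_family_on_def
  proof (intro ballI impI)
    fix t t' :: nat assume "t \<noteq> t'"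
    then show "triple_edges (Q t) \<inter> triple_edges (Q t') = {}"
      using Q_col by (intro triple_edges_disjoint) (auto intro: Q_sym dest: Q_col)
  qed
  moreover have "triple_edges (\<lambda>u v. u < n \<and> v < n \<and> u \<noteq> v) = (\<Union>t<N. triple_edges (Q t))"
  proof -
    have "u < n \<and> v < n \<and> u \<noteq> v \<longleftrightarrow> (\<exists>t\<in>{..<N}. Q t u v)" for u v
    proof
      assume uv: "u < n \<and> v < n \<and> u \<noteq> v"
      then have le: "u div m \<le> N" "v div m \<le> N" using div_le by simp_all
      show "\<exists>t\<in>{..<N}. Q t u v"
      proof (cases "u div m = v div m")
        case True
        \<comment> \<open>Whichever partner the group has in the 1-factor 0, the complete graph on
          that pair contains the edge.\<close>
        obtain g' where "g' \<le> N" "g' \<noteq> u div m" "rr_col N (u div m) g' = 0"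
          using rr_col_perfect[OF N(1) le(1) N(3)] by blast
        then obtain j where "j \<in> J 0" "u div m \<in> {fst j, snd j}" using pair[OF le(1)] by metis
        then have "Q 0 u v" using uv True unfolding Q_def R_def V_iff by auto
        then show ?thesis using N(3) by blast
      next
        case False
        define t where "t = rr_col N (u div m) (v div m)"
        obtain j where "j \<in> J t" "u div m \<in> {fst j, snd j}" "v div m \<in> {fst j, snd j}"
          using pair[OF le False] t_def by blast
        then have "Q t u v" using uv False unfolding Q_def R_def V_iff by auto
        moreover have "t < N" using N(3) by (simp add: t_def rr_col_def)
        ultimately show ?thesis by blast
      qed
    next
      assume "\<exists>t\<in>{..<N}. Q t u v"
      then obtain t j where j: "j \<in> J t" "R t j u v" unfolding Q_def by blast
      then have "u div m \<le> N" "v div m \<le> N" using J_le[OF j(1)] unfolding R_def V_iff by auto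
      then show "u < n \<and> v < n \<and> u \<noteq> v" using j(2) div_le unfolding R_def by (auto split: if_splits)
    qed
    then show ?thesis by (simp flip: triple_edges_Union)
  qed
  moreover have "resolvable k ({..<3} \<times> {..<n}) (triple_edges (Q t)) (if t = 0 then 2 * m - 1 else m)"
    if "t < N" for t
    using res[OF that] unfolding triple_edges_Union[symmetric] Q_def .
  moreover have "verts (tensor_product (complete_graph 3) (complete_graph n)) = {..<3} \<times> {..<n}"
    by (simp add: tensor_product_def complete_graph_def)
  moreover have "(0, 0) \<in> {..<3::nat} \<times> {..<n}" using assms by (simp add: n_def)
  then have "{..<3::nat} \<times> {..<n} \<noteq> {}" by blast
  ultimately show ?thesis
    unfolding n_def[symmetric] using assms(2)
    by (intro resolvable_imp_cycle_factorization[where T = "{..<N}" and E = "\<lambda>t. triple_edges (Q t)"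
          and r = "\<lambda>t. if t = 0 then 2 * m - 1 else m"]) (simp_all only: edges_tensor_complete lessThan_iff not_False_eq_True)
qed

end
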